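(* For every integer $n\geqslant 3$, $$ D_n(t)=[(2n-1)t+1]D_{n-1}(t)+2t(1-t)D_{n-1}'(t)+(1-t)[t^{-1}D_{n-1}^{0,1}(t)-tD_{n-1}^{\geqslant 2}(t)]. $$
   Context: $B_n$ is the group of signed permutations $\pi=\pi_1\pi_2\cdots\pi_n$ of $\{1,\dots,n\}$, and $D_n\subset B_n$ is the subgroup (Coxeter group of type $D$) of those with an even number of negative entries. For $n\geqslant 2$, an index $i\in\{0,1,\dots,n-1\}$ is a ($D$-)descent of $\pi$ if $\pi_i>\pi_{i+1}$, where $\pi_0:=-\pi_2$; $d(\pi)$ is the number of descents. For $n\geqslant 2$, $D_n(t)=\sum_{\pi\in D_n}t^{d(\pi)}$ is the Eulerian polynomial of type $D$, and $D_n^{0,1}(t)$, $D_n^{\geqslant 2}(t)$ (sub-Eulerian polynomials) are the sums of $t^{d(\pi)}$ over those $\pi\in D_n$ such that, respectively: both $0$ and $1$ are descents; neither $0$ nor $1$ is a descent. *)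

theory Defs
  imports
    "HOL-Combinatorics.Permutations"
    "HOL-Computational_Algebra.Polynomial_Factorial"
begin

text \<open>A signed permutation \<open>\<pi>\<^sub>1 \<dots> \<pi>\<^sub>n\<close> is identified with the odd bijection \<open>i \<mapsto> \<pi>\<^sub>i\<close>,
  \<open>- i \<mapsto> - \<pi>\<^sub>i\<close> of the nonzero integers of absolute value at most \<open>n\<close>.\<close>

definition signed_perms :: "nat \<Rightarrow> (int \<Rightarrow> int) set" where
  "signed_perms n = {p. p permutes ({- int n..int n} - {0}) \<and> (\<forall>i. p (- i) = - p i)}"

definition even_signed_perms :: "nat \<Rightarrow> (int \<Rightarrow> int) set" where
  "even_signed_perms n =
     {p \<in> signed_perms n. even (card {i \<in> {1..int n}. p i < 0})}"

text \<open>The one-line notation extended to index 0 by \<open>\<pi>\<^sub>0 = - \<pi>\<^sub>2\<close>; this is not the value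
  of the underlying odd bijection at 0.\<close>

definition entry :: "(int \<Rightarrow> int) \<Rightarrow> nat \<Rightarrow> int" where
  "entry p i = (if i = 0 then - p 2 else p (int i))"

definition descents :: "nat \<Rightarrow> (int \<Rightarrow> int) \<Rightarrow> nat set" where
  "descents n p = {i. i < n \<and> entry p i > entry p (i + 1)}"

definition des :: "nat \<Rightarrow> (int \<Rightarrow> int) \<Rightarrow> nat" where
  "des n p = card (descents n p)"

text \<open>These definitions are meaningful for \<open>n \<ge> 2\<close> only.\<close>

definition eulerian_D :: "nat \<Rightarrow> int poly" where
  "eulerian_D n = (\<Sum>p\<in>even_signed_perms n. monom 1 (des n p))"

definition eulerian_D_01 :: "nat \<Rightarrow> int poly" where
  "eulerian_D_01 n =
     (\<Sum>p\<in>{p \<in> even_signed_perms n. 0 \<in> descents n p \<and> 1 \<in> descents n p}. monom 1 (des n p))"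

definition eulerian_D_ge2 :: "nat \<Rightarrow> int poly" where
  "eulerian_D_ge2 n =
     (\<Sum>p\<in>{p \<in> even_signed_perms n. 0 \<notin> descents n p \<and> 1 \<notin> descents n p}. monom 1 (des n p))"

end

theory Submission
  imports Defs
begin

text \<open>
  Every signed permutation of size \<open>m + 1\<close> arises exactly once from one of size \<open>m\<close> by inserting
  the letter \<open>m + 1\<close> or \<open>- (m + 1)\<close> somewhere in its one-line notation. A letter of maximal absolute
  value inserted at the right of the second letter keeps the number of descents if it lands in a
  descent and raises it by one if it lands in an ascent; the derivative in the recurrence comes
  from this dichotomy. Near the first two letters the insertion also disturbs the descents 0 and 1,
  and the terms with \<open>D\<^sup>0\<^sup>1\<close> and \<open>D\<^sup>\<ge>\<^sup>2\<close> correct for that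
  (\<open>sum_insert_both_signs\<close>).

  Two obstacles remain. Inserting a negative letter, or deleting one, does not stay inside type \<open>D\<close>,
  and a word having only one of the descents 0 and 1 contributes a term whose sign depends on which
  one it has. Both disappear by changing the sign of the first letter. This involution exchanges
  the conditions \<open>\<pi>\<^sub>1 + \<pi>\<^sub>2 < 0\<close> and \<open>\<pi>\<^sub>1 > \<pi>\<^sub>2\<close>, that is, the descents 0 and 1, and leaves all
  others alone; so the number of descents is preserved while the parity of the number of negative
  letters changes. Hence each sum over \<open>D\<^sub>n\<close> is half of the sum over all signed permutations
  (\<open>sum_even_words\<close>), and the terms of ambiguous sign cancel in pairs
  (\<open>sum_desc0_minus_desc1\<close>).

  The recurrence is proved for integer polynomials after multiplication by the indeterminate
  (\<open>eulerian_D_recurrence\<close>) and only then carried over to rational functions, where \<open>t\<close> is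
  invertible.
\<close>

section \<open>Inserting an extreme letter into a word\<close>

fun adj_des :: "int list \<Rightarrow> nat" where
  "adj_des (x # y # zs) = of_bool (x > y) + adj_des (y # zs)"
| "adj_des _ = 0"

definition insert_at :: "nat \<Rightarrow> 'a \<Rightarrow> 'a list \<Rightarrow> 'a list" where
  "insert_at k x w = take k w @ x # drop k w"

lemma insert_at_0 [simp]: "insert_at 0 x w = x # w"
  by (simp add: insert_at_def)

lemma insert_at_Suc [simp]: "insert_at (Suc k) x (y # w) = y # insert_at k x w"
  by (simp add: insert_at_def)

text \<open>The letter \<open>b\<close> only marks the left end: the positions are those to the right of it. A
  new maximum keeps the number of descents in each descent and at the end of the word, and adds one
  descent in each ascent.\<close>

lemma sum_insert_max:
  fixes q :: "'a::comm_ring_1"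
  assumes "\<forall>y\<in>set (b # v). y < x"
  shows "(\<Sum>k\<le>length v. q ^ adj_des (b # insert_at k x v)) =
    q ^ adj_des (b # v) * (1 + of_nat (adj_des (b # v))
      + (of_nat (length v) - of_nat (adj_des (b # v))) * q)"
  using assms
proof (induction v arbitrary: b)
  case Nil
  then show ?case by simp
next
  case (Cons y ys)
  have "(\<Sum>k\<le>length (y # ys). q ^ adj_des (b # insert_at k x (y # ys))) =
      q ^ (1 + adj_des (y # ys))
      + q ^ of_bool (b > y) * (\<Sum>k\<le>length ys. q ^ adj_des (y # insert_at k x ys))"
    using Cons.prems by (simp add: sum.atMost_Suc_shift sum_distrib_left power_add del: sum.atMost_Suc)
  also have "(\<Sum>k\<le>length ys. q ^ adj_des (y # insert_at k x ys)) =
      q ^ adj_des (y # ys) * (1 + of_nat (adj_des (y # ys))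
      + (of_nat (length ys) - of_nat (adj_des (y # ys))) * q)"
    using Cons.prems by (intro Cons.IH) auto
  finally show ?case
    by (cases "b > y") (simp_all add: algebra_simps)
qed

text \<open>In contrast to a maximum, a new minimum creates a descent at the end of the word.\<close>

lemma sum_insert_min:
  fixes q :: "'a::comm_ring_1"
  assumes "\<forall>y\<in>set (b # v). x < y"
  shows "(\<Sum>k\<le>length v. q ^ adj_des (b # insert_at k x v)) =
    q ^ adj_des (b # v) * (of_nat (adj_des (b # v))
      + (1 + of_nat (length v) - of_nat (adj_des (b # v))) * q)"
  using assms
proof (induction v arbitrary: b)
  case Nil
  then show ?case by simp
next
  case (Cons y ys)
  have "(\<Sum>k\<le>length (y # ys). q ^ adj_des (b # insert_at k x (y # ys))) =
      q ^ (1 + adj_des (y # ys))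
      + q ^ of_bool (b > y) * (\<Sum>k\<le>length ys. q ^ adj_des (y # insert_at k x ys))"
    using Cons.prems by (simp add: sum.atMost_Suc_shift sum_distrib_left power_add del: sum.atMost_Suc)
  also have "(\<Sum>k\<le>length ys. q ^ adj_des (y # insert_at k x ys)) =
      q ^ adj_des (y # ys) * (of_nat (adj_des (y # ys))
      + (1 + of_nat (length ys) - of_nat (adj_des (y # ys))) * q)"
    using Cons.prems by (intro Cons.IH) auto
  finally show ?case
    by (cases "b > y") (simp_all add: algebra_simps)
qed

text \<open>List positions are shifted by one: \<open>w ! 0\<close> is the entry \<open>\<pi>\<^sub>1\<close>, and \<open>- (w ! 1)\<close> is the entry
  \<open>\<pi>\<^sub>0 = - \<pi>\<^sub>2\<close>.\<close>

definition desc0 :: "int list \<Rightarrow> bool" where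
  "desc0 w \<longleftrightarrow> - (w ! 1) > w ! 0"

definition desc1 :: "int list \<Rightarrow> bool" where
  "desc1 w \<longleftrightarrow> w ! 0 > w ! 1"

definition desD :: "int list \<Rightarrow> nat" where
  "desD w = of_bool (desc0 w) + adj_des w"

text \<open>The local form of the recurrence. Write \<open>w = a b v\<close>. To the right of \<open>b\<close> the two preceding
  lemmas apply, while an insertion before or after \<open>a\<close> destroys the descent 0 (and the descent 1, if
  after \<open>a\<close>) and creates descents that depend only on the sign of the new letter. The result is
  the contribution of \<open>w\<close> to the right-hand side of the recurrence, up to a last term that is
  antisymmetric in the descents 0 and 1. The factor \<open>q\<close> is there because the contribution of a word
  with both descents contains \<open>q\<close> to the power \<open>desD w - 1\<close>.\<close>

lemma sum_insert_both_signs: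
  fixes q :: "'a::comm_ring_1"
  assumes w: "length w \<ge> 2" and N: "\<forall>y\<in>set w. \<bar>y\<bar> < N"
  shows "q * (\<Sum>x\<in>{N, - N}. \<Sum>k\<le>length w. q ^ desD (insert_at k x w)) =
      q * ((2 * of_nat (length w) + 1) * q + 1) * q ^ desD w
    + 2 * q * (1 - q) * (of_nat (desD w) * q ^ desD w)
    + (1 - q) * (of_bool (desc0 w \<and> desc1 w) * q ^ desD w
                 - q\<^sup>2 * (of_bool (\<not> desc0 w \<and> \<not> desc1 w) * q ^ desD w))
    + q\<^sup>2 * (1 - q) * ((of_bool (desc0 w) - of_bool (desc1 w)) * q ^ adj_des (tl w))"
proof -
  obtain a b v where abv: "w = a # b # v"
    using w by (metis Suc_le_length_iff numeral_2_eq_2)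
  define K where "K = adj_des (b # v)"
  have neq: "N \<noteq> - N" using N abv by auto
  have ab: "\<bar>a\<bar> < N" "\<bar>b\<bar> < N" using N abv by auto
  have len: "length w = Suc (Suc (length v))" using abv by simp
  have split: "(\<Sum>k\<le>length w. q ^ desD (insert_at k x w)) =
      q ^ desD (x # a # b # v) + q ^ desD (a # x # b # v)
      + q ^ (of_bool (- b > a) + of_bool (a > b))
        * (\<Sum>k\<le>length v. q ^ adj_des (b # insert_at k x v))" for x
    unfolding len abv
    by (simp add: sum.atMost_Suc_shift sum_distrib_left power_add desD_def desc0_def mult_ac
        del: sum.atMost_Suc)
  have P: "(\<Sum>k\<le>length w. q ^ desD (insert_at k N w)) =
      q ^ (1 + of_bool (a > b) + K) + q ^ (1 + K)
      + q ^ (of_bool (- b > a) + of_bool (a > b))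
        * (q ^ K * (1 + of_nat K + (of_nat (length v) - of_nat K) * q))"
    unfolding split using N ab abv
    by (subst sum_insert_max) (auto simp: K_def desD_def desc0_def)
  have M: "(\<Sum>k\<le>length w. q ^ desD (insert_at k (- N) w)) =
      q ^ (1 + of_bool (a > b) + K) + q ^ (2 + K)
      + q ^ (of_bool (- b > a) + of_bool (a > b))
        * (q ^ K * (of_nat K + (1 + of_nat (length v) - of_nat K) * q))"
    unfolding split using N ab abv
    by (subst sum_insert_min) (auto simp: K_def desD_def desc0_def)
  have d: "desD w = of_bool (- b > a) + of_bool (a > b) + K"
    "desc0 w \<longleftrightarrow> - b > a" "desc1 w \<longleftrightarrow> a > b" "adj_des (tl w) = K"
    by (simp_all add: abv desD_def desc0_def desc1_def K_def)
  have two: "(\<Sum>x\<in>{N, - N}. f x) = f N + f (- N)" for f :: "int \<Rightarrow> 'a"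
    using neq by simp
  show ?thesis
    unfolding two P M unfolding d len
    by (cases "- b > a"; cases "a > b"; simp add: algebra_simps power2_eq_square)
qed

section \<open>Signed words\<close>

definition signed_words :: "nat \<Rightarrow> int list set" where
  "signed_words n = {w. distinct (map abs w) \<and> abs ` set w = {1..int n}}"

lemma length_signed_word: "w \<in> signed_words n \<Longrightarrow> length w = n"
  using distinct_card[of "map abs w"] by (simp add: signed_words_def)

lemma finite_signed_words: "finite (signed_words n)"
proof (rule finite_subset)
  show "signed_words n \<subseteq> {w. set w \<subseteq> {- int n..int n} \<and> length w = n}"
  proof
    fix w assume w: "w \<in> signed_words n"
    then have "\<bar>x\<bar> \<in> {1..int n}" if "x \<in> set w" for x
      using that by (auto simp: signed_words_def simp del: atLeastAtMost_iff)
    then show "w \<in> {w. set w \<subseteq> {- int n..int n} \<and> length w = n}"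
      using length_signed_word[OF w] by fastforce
  qed
  show "finite {w. set w \<subseteq> {- int n..int n} \<and> length w = n}"
    by (rule finite_lists_length_eq) simp
qed

text \<open>The inverse of the insertion deletes the unique letter of absolute value \<open>m + 1\<close>.\<close>

lemma bij_betw_insert_at:
  "bij_betw (\<lambda>(w, x, k). insert_at k x w)
     (signed_words m \<times> {int (Suc m), - int (Suc m)} \<times> {..m}) (signed_words (Suc m))"
  (is "bij_betw ?f ?A ?B")
proof (rule bij_betw_imageI)
  let ?N = "int (Suc m)"
  have small: "\<bar>y\<bar> < ?N" if "w \<in> signed_words m" "y \<in> set w" for w y
    using that by (force simp: signed_words_def)
  show "inj_on ?f ?A"
  proof (rule inj_onI)
    fix s s' assume s: "s \<in> ?A" "s' \<in> ?A" "?f s = ?f s'"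
    obtain w x k w' x' k' where ss': "s = (w, x, k)" "s' = (w', x', k')"
      by (cases s, cases s')
    have w: "w \<in> signed_words m" "w' \<in> signed_words m"
      and x: "x \<in> {?N, - ?N}" "x' \<in> {?N, - ?N}" and k: "k \<in> {..m}" "k' \<in> {..m}"
      and eq: "insert_at k x w = insert_at k' x' w'"
      using s by (simp_all add: ss')
    \<comment> \<open>The inserted letter does not occur elsewhere, so its position in the word is determined.\<close>
    have notin: "x \<notin> set w" "x \<notin> set w'"
      using small[OF w(1), of x] small[OF w(2), of x] x by auto
    have "x \<in> set (insert_at k' x' w')"
      unfolding eq[symmetric] by (simp add: insert_at_def)
    then have "x = x'"
      using notin(2) by (auto simp: insert_at_def dest: in_set_takeD in_set_dropD)
    moreover have "take k w = take k' w' \<and> drop k w = drop k' w'"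
      using eq notin unfolding insert_at_def \<open>x = x'\<close>
      by (subst (asm) append_Cons_eq_iff) (auto dest: in_set_takeD in_set_dropD)
    ultimately have *: "take k w = take k' w'" "x = x'" "drop k w = drop k' w'"
      by simp_all
    have "k = k'"
      using arg_cong[OF *(1), of length] k length_signed_word[OF w(1)] length_signed_word[OF w(2)]
      by simp
    moreover have "w = w'"
      using * by (metis append_take_drop_id)
    ultimately show "s = s'"
      using * by (simp add: ss')
  qed
  show "?f ` ?A = ?B"
  proof (intro equalityI subsetI)
    fix u assume "u \<in> ?f ` ?A"
    then obtain w x k where w: "w \<in> signed_words m" and x: "x \<in> {?N, - ?N}"
      and u: "u = insert_at k x w" by auto
    have "mset u = mset (x # w)"
      by (metis append_take_drop_id insert_at_def mset.simps(2) mset_append u union_mset_add_mset_right)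
    then have "set u = set (x # w)" "mset (map abs u) = mset (map abs (x # w))"
      by (metis set_mset_mset, simp)
    moreover have "distinct (map abs (x # w))"
      using w x small[OF w] by (auto simp: signed_words_def)
    moreover have "abs ` set (x # w) = {1..?N}"
      using w x by (auto simp: signed_words_def)
    ultimately show "u \<in> ?B"
      unfolding signed_words_def by (metis (mono_tags, lifting) mem_Collect_eq mset_eq_imp_distinct_iff)
  next
    fix u assume u: "u \<in> ?B"
    then have "?N \<in> abs ` set u" by (auto simp: signed_words_def)
    then obtain x where x: "x \<in> set u" "\<bar>x\<bar> = ?N" by auto
    then obtain ys zs where s: "u = ys @ x # zs" by (meson split_list)
    have "?N \<notin> abs ` set (ys @ zs)"
      using u x(2) by (simp add: signed_words_def s image_Un)
    then have "abs ` set (ys @ zs) = abs ` set u - {?N}"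
      using x(2) by (simp add: s image_Un)
    also have "\<dots> = {1..int m}" using u by (auto simp: signed_words_def)
    finally have w: "ys @ zs \<in> signed_words m"
      using u by (auto simp: signed_words_def s)
    have "length ys \<le> m" using length_signed_word[OF w] by simp
    moreover have "u = insert_at (length ys) x (ys @ zs)" by (simp add: insert_at_def s)
    moreover have "x \<in> {?N, - ?N}" using x by auto
    ultimately show "u \<in> ?f ` ?A" using w by (intro image_eqI[of _ _ "(ys @ zs, x, length ys)"]) auto
  qed
qed

lemma sum_signed_words_Suc:
  "(\<Sum>u\<in>signed_words (Suc m). f u) =
     (\<Sum>w\<in>signed_words m. \<Sum>x\<in>{int (Suc m), - int (Suc m)}. \<Sum>k\<le>m. f (insert_at k x w))"
proof -
  have "(\<Sum>u\<in>signed_words (Suc m). f u) =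
      (\<Sum>(w, x, k)\<in>signed_words m \<times> {int (Suc m), - int (Suc m)} \<times> {..m}. f (insert_at k x w))"
    by (subst sum.reindex_bij_betw[OF bij_betw_insert_at, symmetric]) (auto intro!: sum.cong)
  then show ?thesis
    by (simp only: sum.cartesian_product)
qed

section \<open>Changing the sign of the first letter\<close>

fun flip_hd :: "int list \<Rightarrow> int list" where
  "flip_hd (a # v) = - a # v"
| "flip_hd [] = []"

lemma flip_hd_flip_hd [simp]: "flip_hd (flip_hd w) = w"
  by (cases w) auto

lemma flip_hd_signed_words: "w \<in> signed_words n \<Longrightarrow> flip_hd w \<in> signed_words n"
  by (cases w) (auto simp: signed_words_def)

lemma bij_betw_flip_hd: "bij_betw flip_hd (signed_words n) (signed_words n)"
  by (rule bij_betw_byWitness[where f' = flip_hd]) (auto intro: flip_hd_signed_words)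

text \<open>The descents 0 and 1 compare \<open>a\<close> and \<open>- a\<close>, respectively, with \<open>- b\<close>: the former says
  \<open>a < - b\<close>, the latter \<open>- a < - b\<close>.\<close>

lemma
  assumes "length w \<ge> 2"
  shows desc0_flip_hd: "desc0 (flip_hd w) = desc1 w"
    and desc1_flip_hd: "desc1 (flip_hd w) = desc0 w"
    and adj_des_tl_flip_hd: "adj_des (tl (flip_hd w)) = adj_des (tl w)"
    and desD_flip_hd: "desD (flip_hd w) = desD w"
proof -
  obtain a b v where "w = a # b # v"
    using assms by (metis Suc_le_length_iff numeral_2_eq_2)
  then show "desc0 (flip_hd w) = desc1 w" "desc1 (flip_hd w) = desc0 w"
    "adj_des (tl (flip_hd w)) = adj_des (tl w)" "desD (flip_hd w) = desD w"
    by (auto simp: desc0_def desc1_def desD_def)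
qed

definition even_word :: "int list \<Rightarrow> bool" where
  "even_word w \<longleftrightarrow> even (length (filter (\<lambda>x. x < 0) w))"

lemma even_word_flip_hd:
  assumes "w \<in> signed_words n" "n > 0"
  shows "even_word (flip_hd w) \<longleftrightarrow> \<not> even_word w"
proof (cases w)
  case Nil
  then show ?thesis using assms length_signed_word[OF assms(1)] by simp
next
  case (Cons a v)
  then have "a \<noteq> 0" using assms by (force simp: signed_words_def)
  then show ?thesis using Cons by (auto simp: even_word_def)
qed

text \<open>The involution exchanges the even and the odd words and keeps the summand. This makes it
  possible to count in type \<open>B\<close>, where letters of either sign can be inserted freely.\<close>

lemma sum_even_words:
  fixes f :: "int list \<Rightarrow> 'a::comm_ring_1"
  assumes "n > 0" and f: "\<And>w. w \<in> signed_words n \<Longrightarrow> f (flip_hd w) = f w"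
  shows "2 * (\<Sum>w\<in>{w \<in> signed_words n. even_word w}. f w) = (\<Sum>w\<in>signed_words n. f w)"
proof -
  have "bij_betw flip_hd {w \<in> signed_words n. even_word w} {w \<in> signed_words n. \<not> even_word w}"
    by (rule bij_betw_byWitness[where f' = flip_hd])
       (auto simp: even_word_flip_hd assms(1) intro: flip_hd_signed_words)
  from sum.reindex_bij_betw[OF this, of f]
  have odd: "(\<Sum>w\<in>{w \<in> signed_words n. \<not> even_word w}. f w) =
      (\<Sum>w\<in>{w \<in> signed_words n. even_word w}. f w)"
    by (auto simp: f intro!: sum.cong)
  have "(\<Sum>w\<in>signed_words n. f w) =
      (\<Sum>w\<in>{w \<in> signed_words n. even_word w} \<union> {w \<in> signed_words n. \<not> even_word w}. f w)"
    by (intro sum.cong) auto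
  also have "\<dots> = 2 * (\<Sum>w\<in>{w \<in> signed_words n. even_word w}. f w)"
    by (subst sum.union_disjoint) (auto simp: odd finite_signed_words)
  finally show ?thesis by simp
qed

text \<open>The involution turns this sum, which collects the antisymmetric terms of
  \<open>sum_insert_both_signs\<close>, into its negative.\<close>

lemma sum_desc0_minus_desc1:
  fixes q :: "int poly"
  assumes "n \<ge> 2"
  shows "(\<Sum>w\<in>signed_words n. (of_bool (desc0 w) - of_bool (desc1 w)) * q ^ adj_des (tl w)) = 0"
    (is "?S = 0")
proof -
  have "?S = (\<Sum>w\<in>signed_words n.
      (of_bool (desc0 (flip_hd w)) - of_bool (desc1 (flip_hd w))) * q ^ adj_des (tl (flip_hd w)))"
    by (rule sum.reindex_bij_betw[OF bij_betw_flip_hd, symmetric])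
  also have "\<dots> = - ?S"
    unfolding sum_negf[symmetric]
    using assms length_signed_word
    by (intro sum.cong)
       (auto simp: desc0_flip_hd desc1_flip_hd adj_des_tl_flip_hd algebra_simps)
  finally show ?thesis by simp
qed

section \<open>Signed permutations in one-line notation\<close>

definition word :: "nat \<Rightarrow> (int \<Rightarrow> int) \<Rightarrow> int list" where
  "word n p = map (\<lambda>i. p (int i)) [1..<Suc n]"

lemma nth_word: "i < n \<Longrightarrow> word n p ! i = p (int i + 1)"
  by (simp add: word_def add.commute del: upt_Suc)

lemma length_word [simp]: "length (word n p) = n"
  by (simp add: word_def)

lemma signed_perm_odd: "p \<in> signed_perms n \<Longrightarrow> p (- i) = - p i"
  by (simp add: signed_perms_def)

text \<open>Oddness is what makes the absolute values of the letters distinct: from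
  \<open>\<bar>p i\<bar> = \<bar>p j\<bar>\<close> it follows that \<open>p i\<close> is \<open>p j\<close> or \<open>p (- j)\<close>.\<close>

lemma word_in_signed_words:
  assumes p: "p \<in> signed_perms n"
  shows "word n p \<in> signed_words n"
proof -
  have perm: "p permutes ({- int n..int n} - {0})"
    using p by (simp add: signed_perms_def)
  have inj: "inj_on (\<lambda>i. \<bar>p (int i)\<bar>) {1..<Suc n}"
  proof (rule inj_onI)
    fix i j assume ij: "i \<in> {1..<Suc n}" "j \<in> {1..<Suc n}" "\<bar>p (int i)\<bar> = \<bar>p (int j)\<bar>"
    then have "p (int i) = p (int j) \<or> p (int i) = p (- int j)"
      by (auto simp: signed_perm_odd[OF p] abs_eq_iff)
    then have "int i = int j \<or> int i = - int j"
      using permutes_inj[OF perm] by (meson injD)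
    then show "i = j" using ij by auto
  qed
  have "(\<lambda>i. \<bar>p (int i)\<bar>) ` {1..<Suc n} \<subseteq> {1..int n}"
  proof (rule image_subsetI)
    fix i assume "i \<in> {1..<Suc n}"
    then have "int i \<in> {- int n..int n} - {0}" by auto
    then have "p (int i) \<in> {- int n..int n} - {0}" using permutes_in_image[OF perm] by blast
    then show "\<bar>p (int i)\<bar> \<in> {1..int n}" by auto
  qed
  then have "(\<lambda>i. \<bar>p (int i)\<bar>) ` {1..<Suc n} = {1..int n}"
    using card_image[OF inj] by (intro card_subset_eq) auto
  moreover have "distinct (map (\<lambda>i. \<bar>p (int i)\<bar>) [1..<Suc n])"
    using inj by (simp only: distinct_map distinct_upt set_upt)
  ultimately show ?thesis
    by (simp add: signed_words_def word_def image_image o_def del: upt_Suc)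
qed

lemma bij_betw_word: "bij_betw (word n) (signed_perms n) (signed_words n)"
proof (rule bij_betw_imageI)
  let ?S = "{- int n..int n} - {0}"
  show "inj_on (word n) (signed_perms n)"
  proof (rule inj_onI, rule ext)
    fix p q :: "int \<Rightarrow> int" and i
    assume p: "p \<in> signed_perms n" and q: "q \<in> signed_perms n" and eq: "word n p = word n q"
    have pos: "p j = q j" if "1 \<le> j" "j \<le> int n" for j
      using arg_cong[OF eq, of "\<lambda>w. w ! nat (j - 1)"] that by (simp add: nth_word)
    show "p i = q i"
    proof (cases "i \<in> ?S")
      case False
      then show ?thesis
        using p q by (metis (mono_tags, lifting) mem_Collect_eq permutes_not_in signed_perms_def)
    next
      case True
      show ?thesis
      proof (cases "i > 0")
        case True
        then show ?thesis using pos[of i] \<open>i \<in> ?S\<close> by auto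
      next
        case False
        then have "p (- i) = q (- i)" using pos[of "- i"] \<open>i \<in> ?S\<close> by auto
        then show ?thesis using signed_perm_odd[OF p] signed_perm_odd[OF q] by simp
      qed
    qed
  qed
  show "word n ` signed_perms n = signed_words n"
  proof (intro equalityI subsetI)
    fix w assume "w \<in> word n ` signed_perms n"
    then show "w \<in> signed_words n" using word_in_signed_words by auto
  next
    fix w assume w: "w \<in> signed_words n"
    note len = length_signed_word[OF w]
    \<comment> \<open>The odd extension of the word, and the identity outside the permuted set.\<close>
    define p where "p i = (if i \<in> ?S then sgn i * w ! (nat \<bar>i\<bar> - 1) else i)" for i
    have entry: "\<bar>w ! j\<bar> \<in> {1..int n}" if "j < n" for j
      using w nth_mem[of j w] that len unfolding signed_words_def by blast
    have ix: "nat \<bar>i\<bar> - 1 < n" if "i \<in> ?S" for i using that by auto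
    have absp: "\<bar>p i\<bar> = \<bar>w ! (nat \<bar>i\<bar> - 1)\<bar>" if "i \<in> ?S" for i
      using that by (auto simp: p_def abs_mult)
    have odd: "p (- i) = - p i" for i
      by (auto simp: p_def)
    have inj: "inj_on p ?S"
    proof (rule inj_onI)
      fix i j assume ij: "i \<in> ?S" "j \<in> ?S" "p i = p j"
      then have "map abs w ! (nat \<bar>i\<bar> - 1) = map abs w ! (nat \<bar>j\<bar> - 1)"
        using absp[of i] absp[of j] ix[of i] ix[of j] len by simp
      then have "nat \<bar>i\<bar> - 1 = nat \<bar>j\<bar> - 1"
        using w ix[OF ij(1)] ix[OF ij(2)] len
        by (subst (asm) nth_eq_iff_index_eq) (auto simp: signed_words_def)
      then have "i = j \<or> i = - j" using ij by auto
      moreover have "p j \<noteq> 0" using absp[OF ij(2)] entry[OF ix[OF ij(2)]] by auto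
      ultimately show "i = j" using odd[of j] ij(3) by auto
    qed
    have maps: "p i \<in> ?S" if "i \<in> ?S" for i
    proof -
      have "\<bar>p i\<bar> \<in> {1..int n}"
        unfolding absp[OF that] by (rule entry[OF ix[OF that]])
      then show ?thesis by auto
    qed
    have fixes_rest: "p i = i" if "i \<notin> ?S" for i
      unfolding p_def using that by (rule if_not_P)
    have "p permutes ?S"
      by (rule inj_imp_permutes[OF inj _ maps fixes_rest]) simp_all
    then have "p \<in> signed_perms n" using odd by (simp add: signed_perms_def)
    moreover have "word n p = w"
      using len by (intro nth_equalityI) (auto simp: nth_word p_def nat_add_distrib)
    ultimately show "w \<in> word n ` signed_perms n" by auto
  qed
qed

lemma even_word_word: "even_word (word n p) \<longleftrightarrow> even (card {i \<in> {1..int n}. p i < 0})"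
proof -
  have "{i \<in> {1..int n}. p i < 0} = int ` {i \<in> {1..<Suc n}. p (int i) < 0}"
  proof (intro equalityI subsetI)
    fix i assume "i \<in> {i \<in> {1..int n}. p i < 0}"
    then show "i \<in> int ` {i \<in> {1..<Suc n}. p (int i) < 0}"
      by (intro image_eqI[of _ _ "nat i"]) auto
  qed auto
  then have "card {i \<in> {1..int n}. p i < 0} = card {i \<in> {1..<Suc n}. p (int i) < 0}"
    by (simp add: card_image)
  also have "\<dots> = length (filter (\<lambda>x. x < 0) (word n p))"
    by (simp add: word_def length_filter_map distinct_length_filter o_def Int_def conj_commute del: upt_Suc)
  finally show ?thesis by (simp add: even_word_def)
qed

lemma adj_des_map_upt:
  "adj_des (map f [a..<Suc b]) = card {i \<in> {a..<b}. f i > f (Suc i)}"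
proof (induction "b - a" arbitrary: a)
  case 0
  then show ?case by (cases "a = b") auto
next
  case (Suc d)
  then have ab: "a < b" by simp
  have "adj_des (map f [a..<Suc b]) = of_bool (f a > f (Suc a)) + adj_des (map f [Suc a..<Suc b])"
    using ab by (simp add: upt_conv_Cons del: upt_Suc)
  also have "adj_des (map f [Suc a..<Suc b]) = card {i \<in> {Suc a..<b}. f i > f (Suc i)}"
    using Suc by (intro Suc.hyps(1)) simp
  also have "{i \<in> {a..<b}. f i > f (Suc i)} =
      (if f a > f (Suc a) then {a} else {}) \<union> {i \<in> {Suc a..<b}. f i > f (Suc i)}"
    using ab by (auto simp: Suc_le_eq le_less)
  then have "of_bool (f a > f (Suc a)) + card {i \<in> {Suc a..<b}. f i > f (Suc i)} =
      card {i \<in> {a..<b}. f i > f (Suc i)}"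
    by auto
  finally show ?case .
qed

lemma
  assumes "n \<ge> 2"
  shows desc0_word: "desc0 (word n p) \<longleftrightarrow> 0 \<in> descents n p"
    and desc1_word: "desc1 (word n p) \<longleftrightarrow> 1 \<in> descents n p"
    and desD_word: "desD (word n p) = des n p"
proof -
  show 0: "desc0 (word n p) \<longleftrightarrow> 0 \<in> descents n p"
    using assms by (simp add: desc0_def nth_word descents_def entry_def)
  show "desc1 (word n p) \<longleftrightarrow> 1 \<in> descents n p"
    using assms by (simp add: desc1_def nth_word descents_def entry_def)
  have "adj_des (word n p) = card {i \<in> {1..<n}. p (int i) > p (int (Suc i))}"
    unfolding word_def by (rule adj_des_map_upt)
  also have "{i \<in> {1..<n}. p (int i) > p (int (Suc i))} = descents n p - {0}"
    by (auto simp: descents_def entry_def add.commute split: if_splits)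
  finally show "desD (word n p) = des n p"
    unfolding desD_def des_def 0
    using card_Suc_Diff1[of "descents n p" 0] by (auto simp: descents_def)
qed

lemma sum_even_signed_perms:
  fixes f :: "int list \<Rightarrow> int poly"
  shows "(\<Sum>p\<in>even_signed_perms n. f (word n p)) = (\<Sum>w\<in>{w \<in> signed_words n. even_word w}. f w)"
proof -
  have "bij_betw (word n) (even_signed_perms n) {w \<in> signed_words n. even_word w}"
    unfolding even_signed_perms_def even_word_word[symmetric]
    using bij_betw_word[of n] by (auto simp: bij_betw_def inj_on_def)
  then show ?thesis by (rule sum.reindex_bij_betw)
qed

text \<open>One statement for the three polynomials of type \<open>D\<close>: the predicate \<open>P\<close> prescribes which of
  the descents 0 and 1 occur. The symmetry of \<open>P\<close> makes the condition invariant under changing the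
  sign of the first letter.\<close>

lemma twice_eulerian:
  fixes P :: "bool \<Rightarrow> bool \<Rightarrow> bool"
  assumes n: "n \<ge> 2" and P: "\<And>x y. P x y = P y x"
  shows "2 * (\<Sum>p\<in>{p \<in> even_signed_perms n. P (0 \<in> descents n p) (1 \<in> descents n p)}. monom 1 (des n p)) =
    (\<Sum>w\<in>signed_words n. of_bool (P (desc0 w) (desc1 w)) * monom 1 1 ^ desD w :: int poly)"
proof -
  define f :: "int list \<Rightarrow> int poly" where
    "f w = of_bool (P (desc0 w) (desc1 w)) * monom 1 1 ^ desD w" for w
  have fin: "finite (even_signed_perms n)"
    by (rule finite_subset[of _ "{p. p permutes ({- int n..int n} - {0})}"])
       (auto simp: even_signed_perms_def signed_perms_def intro: finite_permutations)
  have "(\<Sum>p\<in>{p \<in> even_signed_perms n. P (0 \<in> descents n p) (1 \<in> descents n p)}. monom 1 (des n p)) =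
      (\<Sum>p\<in>even_signed_perms n. f (word n p))"
    by (simp add: f_def sum.inter_filter[OF fin] desc0_word[OF n] desc1_word[OF n] desD_word[OF n]
        monom_power of_bool_def if_distrib if_distribR cong: if_cong)
  also have "2 * \<dots> = (\<Sum>w\<in>signed_words n. f w)"
    unfolding sum_even_signed_perms
  proof (rule sum_even_words)
    fix w assume "w \<in> signed_words n"
    then have "length w \<ge> 2" using n length_signed_word by simp
    then show "f (flip_hd w) = f w"
      by (simp add: f_def desc0_flip_hd desc1_flip_hd desD_flip_hd P[of "desc1 w"])
  qed (use n in simp)
  finally show ?thesis by (simp add: f_def)
qed

section \<open>The recurrence\<close>

lemma pderiv_sum: "pderiv (\<Sum>i\<in>A. f i) = (\<Sum>i\<in>A. pderiv (f i))"
  using higher_pderiv_sum[of 1 f A] by simp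

text \<open>The factor \<open>monom 1 1\<close> avoids the exponent \<open>d - 1\<close>, which would need a case distinction at
  \<open>d = 0\<close>.\<close>

lemma monom_times_pderiv_monom:
  "monom 1 1 * pderiv (monom (1::int) d) = of_nat d * monom 1 1 ^ d"
  by (cases d) (simp_all add: pderiv_monom monom_power mult_monom of_nat_poly smult_monom)

text \<open>All sums are doubled so that they range over all signed words; the factor 2 is cancelled at the
  end. Multiplying by \<open>X\<close> clears the denominator \<open>t\<close> of the recurrence.\<close>

lemma eulerian_D_recurrence:
  fixes X :: "int poly"
  assumes m: "m \<ge> 2"
  defines "X \<equiv> monom 1 1"
  shows "X * eulerian_D (Suc m) =
      X * ((2 * of_nat m + 1) * X + 1) * eulerian_D m
    + 2 * X * (1 - X) * (X * pderiv (eulerian_D m))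
    + (1 - X) * (eulerian_D_01 m - X\<^sup>2 * eulerian_D_ge2 m)"
proof -
  let ?W = "signed_words m"
  have D: "2 * eulerian_D k = (\<Sum>w\<in>signed_words k. X ^ desD w)" if "k \<ge> 2" for k
    using twice_eulerian[OF that, of "\<lambda>_ _. True"] by (simp add: eulerian_D_def X_def)
  have D01: "2 * eulerian_D_01 m = (\<Sum>w\<in>?W. of_bool (desc0 w \<and> desc1 w) * X ^ desD w)"
    unfolding eulerian_D_01_def X_def
    using twice_eulerian[OF m, of "\<lambda>x y. x \<and> y"] by (simp add: conj_commute)
  have Dge2: "2 * eulerian_D_ge2 m = (\<Sum>w\<in>?W. of_bool (\<not> desc0 w \<and> \<not> desc1 w) * X ^ desD w)"
    unfolding eulerian_D_ge2_def X_def
    using twice_eulerian[OF m, of "\<lambda>x y. \<not> x \<and> \<not> y"] by (simp add: conj_commute)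
  have "2 * (X * pderiv (eulerian_D m)) = X * pderiv (2 * eulerian_D m)"
    by (simp add: pderiv_mult)
  also have "\<dots> = (\<Sum>w\<in>?W. of_nat (desD w) * X ^ desD w)"
    unfolding D[OF m] pderiv_sum sum_distrib_left
    using monom_times_pderiv_monom by (simp add: X_def monom_power)
  finally have D': "2 * (X * pderiv (eulerian_D m)) = (\<Sum>w\<in>?W. of_nat (desD w) * X ^ desD w)" .
  have "2 * (X * eulerian_D (Suc m)) = X * (2 * eulerian_D (Suc m))" by simp
  also have "\<dots> = (\<Sum>w\<in>?W. X *
      (\<Sum>x\<in>{int (Suc m), - int (Suc m)}. \<Sum>k\<le>m. X ^ desD (insert_at k x w)))"
    using m by (subst D) (simp_all only: sum_signed_words_Suc sum_distrib_left le_SucI)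
  also have "\<dots> = (\<Sum>w\<in>?W.
      X * ((2 * of_nat m + 1) * X + 1) * X ^ desD w
    + 2 * X * (1 - X) * (of_nat (desD w) * X ^ desD w)
    + (1 - X) * (of_bool (desc0 w \<and> desc1 w) * X ^ desD w
                 - X\<^sup>2 * (of_bool (\<not> desc0 w \<and> \<not> desc1 w) * X ^ desD w))
    + X\<^sup>2 * (1 - X) * ((of_bool (desc0 w) - of_bool (desc1 w)) * X ^ adj_des (tl w)))"
  proof (rule sum.cong[OF refl])
    fix w assume w: "w \<in> ?W"
    have "\<forall>y\<in>set w. \<bar>y\<bar> < int (Suc m)" using w by (force simp: signed_words_def)
    with sum_insert_both_signs[of w "int (Suc m)" X] m length_signed_word[OF w]
    show "X * (\<Sum>x\<in>{int (Suc m), - int (Suc m)}. \<Sum>k\<le>m. X ^ desD (insert_at k x w)) =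
        X * ((2 * of_nat m + 1) * X + 1) * X ^ desD w
      + 2 * X * (1 - X) * (of_nat (desD w) * X ^ desD w)
      + (1 - X) * (of_bool (desc0 w \<and> desc1 w) * X ^ desD w
                   - X\<^sup>2 * (of_bool (\<not> desc0 w \<and> \<not> desc1 w) * X ^ desD w))
      + X\<^sup>2 * (1 - X) * ((of_bool (desc0 w) - of_bool (desc1 w)) * X ^ adj_des (tl w))"
      by metis
  qed
  also have "\<dots> = X * ((2 * of_nat m + 1) * X + 1) * (2 * eulerian_D m)
      + 2 * X * (1 - X) * (2 * (X * pderiv (eulerian_D m)))
      + (1 - X) * (2 * eulerian_D_01 m - X\<^sup>2 * (2 * eulerian_D_ge2 m))"
    unfolding D[OF m] D' D01 Dge2
    by (simp only: sum.distrib sum_subtractf sum_distrib_left[symmetric]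
        sum_desc0_minus_desc1[OF m] mult_zero_right add_0_right)
  also have "\<dots> = 2 * (X * ((2 * of_nat m + 1) * X + 1) * eulerian_D m
    + 2 * X * (1 - X) * (X * pderiv (eulerian_D m))
    + (1 - X) * (eulerian_D_01 m - X\<^sup>2 * eulerian_D_ge2 m))"
    by (simp add: algebra_simps)
  finally show ?thesis by simp
qed

theorem corollary4p5:
  fixes n :: nat and t :: "int poly fract"
  assumes "n \<ge> 3"
  defines "t \<equiv> to_fract (monom 1 1)"
  shows "to_fract (eulerian_D n) =
      ((2 * of_nat n - 1) * t + 1) * to_fract (eulerian_D (n - 1))
    + 2 * t * (1 - t) * to_fract (pderiv (eulerian_D (n - 1)))
    + (1 - t) * (inverse t * to_fract (eulerian_D_01 (n - 1))
                 - t * to_fract (eulerian_D_ge2 (n - 1)))"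
proof -
  obtain m where nm: "n = Suc m" and m: "m \<ge> 2"
    using assms(1) by (cases n) auto
  have t0: "t \<noteq> 0"
    by (simp add: t_def monom_eq_0_iff)
  have nat: "to_fract (of_nat k) = (of_nat k :: int poly fract)" for k
    by (induction k) (simp_all add: to_fract_add)
  have num: "to_fract 2 = (2 :: int poly fract)"
    using nat[of 2] by simp
  have "t * to_fract (eulerian_D n) =
      t * ((2 * of_nat m + 1) * t + 1) * to_fract (eulerian_D m)
    + 2 * t * (1 - t) * (t * to_fract (pderiv (eulerian_D m)))
    + (1 - t) * (to_fract (eulerian_D_01 m) - t\<^sup>2 * to_fract (eulerian_D_ge2 m))"
    using arg_cong[OF eulerian_D_recurrence[OF m], of to_fract]
    unfolding nm t_def by (simp only: power2_eq_square to_fract_add to_fract_diff to_fract_mult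
        to_fract_1 nat num)
  also have "\<dots> = t * (((2 * of_nat n - 1) * t + 1) * to_fract (eulerian_D (n - 1))
    + 2 * t * (1 - t) * to_fract (pderiv (eulerian_D (n - 1)))
    + (1 - t) * (inverse t * to_fract (eulerian_D_01 (n - 1))
                 - t * to_fract (eulerian_D_ge2 (n - 1))))"
    using t0 by (simp add: nm field_simps power2_eq_square)
  finally show ?thesis using t0 by simp
qed

end
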